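(* Let $Q\in\mathcal{S}^n$ be a matrix whose convexity graph $G_Q$ is SPN completable, and let $\mathfrak{C}$ be the collection of all maximal cliques of $G_Q$. Then $Q\in\mathcal{Q}^n$ if and only if $$\min_{C\in\mathfrak{C}}\ell(Q_{CC})=\nu(Q).$$
   Context: $\mathcal{S}^m$ is the space of real symmetric $m\times m$ matrices, with trace inner product $\langle U,V\rangle=\sum_{i,j}U_{ij}V_{ij}$; $e$ is the all-ones vector, $E=ee^T$; $\Delta_m=\{x\in\mathbb{R}^m: e^Tx=1,\ x\ge 0\}$. $\mathcal{DN}^m$ is the cone of matrices in $\mathcal{S}^m$ that are both positive semidefinite and entrywise nonnegative. $\mathcal{SPN}^m$ is the cone of matrices in $\mathcal{S}^m$ that are the sum of a positive semidefinite matrix and an entrywise nonnegative symmetric matrix. For any $m$ and $M\in\mathcal{S}^m$: $\nu(M)=\min\{x^TMx: x\in\Delta_m\}$ and $\ell(M)=\min\{\langle M,X\rangle:\langle E,X\rangle=1,\ X\in\mathcal{DN}^m\}$. $\mathcal{Q}^m=\{M\in\mathcal{S}^m:\ell(M)=\nu(M)\}$. The convexity graph of $Q\in\mathcal{S}^n$ is the simple undirected graph $G_Q=(V_Q,E_Q)$ with $V_Q=\{1,\dots,n\}$ and $E_Q=\{(i,j):1\le i<j\le n,\ 2Q_{ij}<Q_{ii}+Q_{jj}\}$. A clique is a set of mutually adjacent vertices (single vertices are cliques); it is maximal if it is not a proper subset of another clique. $Q_{CC}\in\mathcal{S}^{|C|}$ denotes the principal submatrix of $Q$ with rows and columns indexed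 by $C$. SPN completability: for a simple undirected graph $G$ on $\{1,\dots,n\}$, a $G$-partial matrix $B$ is a partial symmetric $n\times n$ real matrix whose entry $B_{ij}=B_{ji}$ is specified if and only if $i=j$ or $(i,j)$ is an edge of $G$. It is a $G$-partial SPN matrix if each of its fully specified $r\times r$ principal submatrices belongs to $\mathcal{SPN}^r$, $r=1,\dots,n$. It is SPN completable if there is $\widehat{B}\in\mathcal{SPN}^n$ agreeing with $B$ on all specified entries. The graph $G$ is SPN completable if every $G$-partial SPN matrix is SPN completable. *)

theory Defs
  imports "HOL-Analysis.Analysis" "Jordan_Normal_Form.DL_Submatrix"
begin

definition sym_mats :: "nat \<Rightarrow> real mat set" where
  "sym_mats m = {M \<in> carrier_mat m m. transpose_mat M = M}"

definition mat_inner :: "real mat \<Rightarrow> real mat \<Rightarrow> real" where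
  "mat_inner U V = (\<Sum>i<dim_row U. \<Sum>j<dim_col U. U $$ (i,j) * V $$ (i,j))"

definition ones_vec :: "nat \<Rightarrow> real vec" where
  "ones_vec m = Matrix.vec m (\<lambda>_. 1)"

definition ones_mat :: "nat \<Rightarrow> real mat" where
  "ones_mat m = Matrix.mat m m (\<lambda>_. 1)"

definition std_simplex :: "nat \<Rightarrow> real vec set" where
  "std_simplex m =
     {x \<in> carrier_vec m. scalar_prod (ones_vec m) x = 1 \<and> (\<forall>i<m. vec_index x i \<ge> 0)}"

definition quad_form :: "real mat \<Rightarrow> real vec \<Rightarrow> real" where
  "quad_form M x = scalar_prod x (M *\<^sub>v x)"

definition psd_mats :: "nat \<Rightarrow> real mat set" where
  "psd_mats m = {M \<in> sym_mats m. \<forall>x \<in> carrier_vec m. quad_form M x \<ge> 0}"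

definition nonneg_mats :: "nat \<Rightarrow> real mat set" where
  "nonneg_mats m = {M \<in> sym_mats m. \<forall>i<m. \<forall>j<m. M $$ (i,j) \<ge> 0}"

definition DN :: "nat \<Rightarrow> real mat set" where
  "DN m = psd_mats m \<inter> nonneg_mats m"

definition SPN :: "nat \<Rightarrow> real mat set" where
  "SPN m = {P + N | P N. P \<in> psd_mats m \<and> N \<in> nonneg_mats m}"

(* The two minima are written as infima; nu_attained and ell_attained below show that
   they are attained in every dimension m > 0. *)

definition nu :: "real mat \<Rightarrow> real" where
  "nu M = (INF x \<in> std_simplex (dim_row M). quad_form M x)"

definition DN_feasible :: "nat \<Rightarrow> real mat set" where
  "DN_feasible m = {X \<in> DN m. mat_inner (ones_mat m) X = 1}"

definition ell :: "real mat \<Rightarrow> real" where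
  "ell M = (INF X \<in> DN_feasible (dim_row M). mat_inner M X)"

definition exact_mats :: "nat \<Rightarrow> real mat set" where
  "exact_mats m = {M \<in> sym_mats m. ell M = nu M}"

(* A simple graph on the vertex set {..<n} is given by its set of edges {i,j}, i \<noteq> j;
   vertices are numbered from 0, as are matrix rows and columns. *)

definition simple_graph :: "nat \<Rightarrow> nat set set \<Rightarrow> bool" where
  "simple_graph n E \<longleftrightarrow> E \<subseteq> {{i,j} | i j. i < n \<and> j < n \<and> i \<noteq> j}"

definition clique :: "nat \<Rightarrow> nat set set \<Rightarrow> nat set \<Rightarrow> bool" where
  "clique n E C \<longleftrightarrow> C \<subseteq> {..<n} \<and> (\<forall>i\<in>C. \<forall>j\<in>C. i \<noteq> j \<longrightarrow> {i,j} \<in> E)"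

definition maximal_cliques :: "nat \<Rightarrow> nat set set \<Rightarrow> nat set set" where
  "maximal_cliques n E = {C. clique n E C \<and> \<not> (\<exists>D. clique n E D \<and> C \<subset> D)}"

definition convexity_graph :: "real mat \<Rightarrow> nat set set" where
  "convexity_graph Q =
     {{i,j} | i j. i < j \<and> j < dim_row Q \<and> 2 * Q $$ (i,j) < Q $$ (i,i) + Q $$ (j,j)}"

abbreviation principal_submatrix :: "'a mat \<Rightarrow> nat set \<Rightarrow> 'a mat" where
  "principal_submatrix M C \<equiv> submatrix M C C"

(* Unspecified entries of a partial matrix are None. *)

definition partial_mat :: "nat \<Rightarrow> nat set set \<Rightarrow> real option mat \<Rightarrow> bool" where
  "partial_mat n E B \<longleftrightarrow>
     B \<in> carrier_mat n n \<and> transpose_mat B = B \<and>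
     (\<forall>i<n. \<forall>j<n. B $$ (i,j) \<noteq> None \<longleftrightarrow> i = j \<or> {i,j} \<in> E)"

definition partial_SPN_mat :: "nat \<Rightarrow> nat set set \<Rightarrow> real option mat \<Rightarrow> bool" where
  "partial_SPN_mat n E B \<longleftrightarrow>
     partial_mat n E B \<and>
     (\<forall>K \<subseteq> {..<n}. K \<noteq> {} \<longrightarrow> (\<forall>i\<in>K. \<forall>j\<in>K. B $$ (i,j) \<noteq> None) \<longrightarrow>
        map_mat the (principal_submatrix B K) \<in> SPN (card K))"

definition SPN_completable_mat :: "nat \<Rightarrow> real option mat \<Rightarrow> bool" where
  "SPN_completable_mat n B \<longleftrightarrow>
     (\<exists>A \<in> SPN n. \<forall>i<n. \<forall>j<n. \<forall>b. B $$ (i,j) = Some b \<longrightarrow> A $$ (i,j) = b)"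

definition SPN_completable :: "nat \<Rightarrow> nat set set \<Rightarrow> bool" where
  "SPN_completable n E \<longleftrightarrow>
     simple_graph n E \<and> (\<forall>B. partial_SPN_mat n E B \<longrightarrow> SPN_completable_mat n B)"

lemma simple_graph_convexity_graph: "simple_graph (dim_row Q) (convexity_graph Q)"
  unfolding simple_graph_def convexity_graph_def
proof
  fix e assume "e \<in> {{i,j} | i j. i < j \<and> j < dim_row Q \<and> 2 * Q $$ (i,j) < Q $$ (i,i) + Q $$ (j,j)}"
  then obtain i j where "e = {i,j}" "i < j" "j < dim_row Q" by (elim CollectE exE conjE)
  then have "e = {i,j} \<and> i < dim_row Q \<and> j < dim_row Q \<and> i \<noteq> j" by simp
  then show "e \<in> {{i,j} | i j. i < dim_row Q \<and> j < dim_row Q \<and> i \<noteq> j}" by (intro CollectI exI)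
qed

lemma finite_maximal_cliques: "finite (maximal_cliques n E)"
  by (rule finite_subset[of _ "Pow {..<n}"]) (auto simp: maximal_cliques_def clique_def)

lemma clique_extends_to_maximal:
  assumes "clique n E C"
  shows "\<exists>D \<in> maximal_cliques n E. C \<subseteq> D"
proof -
  let ?S = "{D. clique n E D \<and> C \<subseteq> D}"
  have "finite ?S"
    by (rule finite_subset[of _ "Pow {..<n}"]) (auto simp: clique_def)
  moreover have "?S \<noteq> {}" using assms by blast
  ultimately obtain D where D: "D \<in> ?S" "\<forall>D' \<in> ?S. D \<subseteq> D' \<longrightarrow> D = D'"
    by (meson finite_has_maximal)
  have "\<not> (\<exists>D'. clique n E D' \<and> D \<subset> D')"
  proof
    assume "\<exists>D'. clique n E D' \<and> D \<subset> D'"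
    then obtain D' where D': "clique n E D'" "D \<subset> D'" by (elim exE conjE)
    then have "D' \<in> ?S" using D(1) by auto
    then show False using D(2) D'(2) by auto
  qed
  then show ?thesis using D(1) unfolding maximal_cliques_def by (intro bexI[of _ D]) auto
qed

lemma maximal_cliques_nonempty: "maximal_cliques n E \<noteq> {}"
proof -
  have "clique n E {}" by (simp add: clique_def)
  then show ?thesis using clique_extends_to_maximal by blast
qed

lemma dim_principal_submatrix:
  assumes "M \<in> carrier_mat n n" "C \<subseteq> {..<n}"
  shows "principal_submatrix M C \<in> carrier_mat (card C) (card C)"
proof -
  have "{i. i < n \<and> i \<in> C} = C" using assms by auto
  moreover have "dim_row M = n" "dim_col M = n" using assms(1) by simp_all
  ultimately show ?thesis by (intro carrier_matI) (simp_all add: dim_submatrix)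
qed

lemma quad_form_eq:
  assumes "M \<in> carrier_mat m m" "x \<in> carrier_vec m"
  shows "quad_form M x = (\<Sum>i<m. \<Sum>j<m. vec_index x i * (M $$ (i,j) * vec_index x j))"
  using assms
  by (auto simp: quad_form_def scalar_prod_def sum_distrib_left atLeast0LessThan
      intro!: sum.cong)

lemma compact_cube: "compact {g :: 'a \<Rightarrow> real. \<forall>p. 0 \<le> g p \<and> g p \<le> 1}"
proof -
  have "compactin (product_topology (\<lambda>_. euclidean) UNIV) (PiE UNIV (\<lambda>_::'a. {0..1::real}))"
    by (simp add: compactin_PiE)
  moreover have "PiE UNIV (\<lambda>_::'a. {0..1::real}) = {g. \<forall>p. 0 \<le> g p \<and> g p \<le> 1}"
    by (auto simp: PiE_def)
  ultimately show ?thesis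
    by (simp add: euclidean_product_topology)
qed

lemma continuous_on_coordinate: "continuous_on A (\<lambda>g :: 'a \<Rightarrow> real. g p)"
  by (rule continuous_on_subset[OF continuous_on_product_coordinates]) simp

lemma nu_attained:
  assumes "M \<in> sym_mats m" "m > 0"
  shows "\<exists>x \<in> std_simplex m. nu M = quad_form M x \<and> (\<forall>y \<in> std_simplex m. quad_form M x \<le> quad_form M y)"
proof -
  have M: "M \<in> carrier_mat m m" and dim: "dim_row M = m" using assms by (auto simp: sym_mats_def)
  define K where "K = {g :: nat \<Rightarrow> real. (\<forall>p. 0 \<le> g p \<and> g p \<le> 1) \<and> (\<Sum>i<m. g i) = 1}"
  define f where "f g = (\<Sum>i<m. \<Sum>j<m. g i * (M $$ (i,j) * g j))" for g :: "nat \<Rightarrow> real"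
  have "closed {g :: nat \<Rightarrow> real. (\<Sum>i<m. g i) = 1}"
    by (intro closed_Collect_eq continuous_on_sum continuous_on_mult continuous_on_const
        continuous_on_coordinate)
  then have "compact ({g :: nat \<Rightarrow> real. \<forall>p. 0 \<le> g p \<and> g p \<le> 1} \<inter> {g. (\<Sum>i<m. g i) = 1})"
    by (intro compact_Int_closed compact_cube)
  then have comp: "compact K" unfolding K_def by (simp add: Collect_conj_eq)
  have "(\<lambda>i. if i = 0 then 1 else 0) \<in> K" using assms(2) by (auto simp: K_def)
  then have ne: "K \<noteq> {}" by blast
  have "continuous_on K f" unfolding f_def
    by (intro continuous_on_sum continuous_on_mult continuous_on_const
        continuous_on_coordinate)
  from continuous_attains_inf[OF comp ne this] obtain g
    where g: "g \<in> K" "\<And>h. h \<in> K \<Longrightarrow> f g \<le> f h" by blast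
  define x where "x = Matrix.vec m g"
  have x: "x \<in> std_simplex m" using g(1)
    by (auto simp: x_def std_simplex_def ones_vec_def scalar_prod_def K_def atLeast0LessThan)
  have fx: "quad_form M x = f g"
    by (subst quad_form_eq[OF M]) (auto simp: x_def f_def)
  have min: "quad_form M x \<le> quad_form M y" if y: "y \<in> std_simplex m" for y
  proof -
    define h where "h i = (if i < m then vec_index y i else 0)" for i
    have s: "(\<Sum>i<m. h i) = 1" and nn: "h p \<ge> 0" for p
      using y by (auto simp: h_def std_simplex_def ones_vec_def scalar_prod_def atLeast0LessThan)
    have "h p \<le> 1" for p
    proof (cases "p < m")
      case True
      then have "h p \<le> (\<Sum>i<m. h i)" using nn by (intro member_le_sum) auto
      then show ?thesis using s by simp
    qed (simp add: h_def)
    then have "h \<in> K" using s nn by (auto simp: K_def)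
    moreover have "quad_form M y = f h"
      using y by (subst quad_form_eq[OF M]) (auto simp: h_def f_def std_simplex_def)
    ultimately show ?thesis using g(2) fx by simp
  qed
  have "nu M = quad_form M x" unfolding nu_def dim
    by (rule cInf_eq_minimum) (use x min in auto)
  then show ?thesis using x min by blast
qed

lemma ell_attained:
  assumes "M \<in> sym_mats m" "m > 0"
  shows "\<exists>X \<in> DN_feasible m. ell M = mat_inner M X \<and> (\<forall>Y \<in> DN_feasible m. mat_inner M X \<le> mat_inner M Y)"
proof -
  have M: "M \<in> carrier_mat m m" and dim: "dim_row M = m" "dim_col M = m"
    using assms by (auto simp: sym_mats_def)
  let ?C = "{g :: nat \<times> nat \<Rightarrow> real. \<forall>p. 0 \<le> g p \<and> g p \<le> 1}"
  let ?S = "{g :: nat \<times> nat \<Rightarrow> real. \<forall>i. \<forall>j. g (i,j) = g (j,i)}"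
  let ?T = "{g :: nat \<times> nat \<Rightarrow> real. (\<Sum>i<m. \<Sum>j<m. g (i,j)) = 1}"
  let ?P = "{g :: nat \<times> nat \<Rightarrow> real. \<forall>x. 0 \<le> (\<Sum>i<m. \<Sum>j<m. x i * (g (i,j) * x j :: real))}"
  define K where "K = ?C \<inter> (?S \<inter> (?T \<inter> ?P))"
  define f where "f g = (\<Sum>i<m. \<Sum>j<m. M $$ (i,j) * g (i,j))" for g :: "nat \<times> nat \<Rightarrow> real"
  have comp: "compact K" unfolding K_def
    by (intro compact_Int_closed compact_cube closed_Int closed_Collect_all closed_Collect_eq
        closed_Collect_le continuous_on_sum continuous_on_mult continuous_on_const
        continuous_on_coordinate)
  define g0 :: "nat \<times> nat \<Rightarrow> real" where "g0 p = (if p = (0,0) then 1 else 0)" for p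
  have row: "(\<Sum>j<m. g0 (i,j)) = (if i = 0 then 1 else 0)" for i
    using assms(2) by (cases i) (auto simp: g0_def)
  have rowx: "(\<Sum>j<m. x i * (g0 (i,j) * x j)) = (if i = 0 then x 0 * x 0 else 0)" for i x
  proof (cases i)
    case 0
    have "(\<Sum>j<m. x i * (g0 (i,j) * x j)) = (\<Sum>j<m. if j = 0 then x 0 * x 0 else 0)"
      by (rule sum.cong) (auto simp: g0_def 0)
    then show ?thesis using assms(2) 0 by simp
  qed (simp add: g0_def)
  have "g0 \<in> K" using assms(2) unfolding K_def by (auto simp: row rowx) (auto simp: g0_def)
  then have ne: "K \<noteq> {}" by blast
  have "continuous_on K f" unfolding f_def
    by (intro continuous_on_sum continuous_on_mult continuous_on_const
        continuous_on_coordinate)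
  from continuous_attains_inf[OF comp ne this] obtain g
    where g: "g \<in> K" "\<And>h. h \<in> K \<Longrightarrow> f g \<le> f h" by blast
  define X where "X = Matrix.mat m m g"
  have Xc: "X \<in> carrier_mat m m" by (simp add: X_def)
  have gsym: "g (i,j) = g (j,i)" for i j using g(1) unfolding K_def by blast
  have Xs: "X \<in> sym_mats m"
    unfolding sym_mats_def using Xc by (auto simp: X_def intro!: eq_matI gsym)
  have gnn: "g p \<ge> 0" for p using g(1) unfolding K_def by blast
  have gpsd: "0 \<le> (\<Sum>i<m. \<Sum>j<m. x i * (g (i,j) * x j))" for x
    using g(1) unfolding K_def by blast
  have gsum: "(\<Sum>i<m. \<Sum>j<m. g (i,j)) = 1" using g(1) unfolding K_def by blast
  have "quad_form X x \<ge> 0" if "x \<in> carrier_vec m" for x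
    using gpsd[of "vec_index x"] by (subst quad_form_eq[OF Xc that]) (simp add: X_def)
  then have X: "X \<in> DN_feasible m"
    using Xs gnn gsum
    by (auto simp: DN_feasible_def DN_def psd_mats_def nonneg_mats_def mat_inner_def ones_mat_def X_def)
  have fX: "mat_inner M X = f g" by (simp add: mat_inner_def dim X_def f_def)
  have min: "mat_inner M X \<le> mat_inner M Y" if Y: "Y \<in> DN_feasible m" for Y
  proof -
    have Yc: "Y \<in> carrier_mat m m" and Yt: "transpose_mat Y = Y"
      and Yn: "\<And>i j. i < m \<Longrightarrow> j < m \<Longrightarrow> Y $$ (i,j) \<ge> 0"
      and Yp: "\<And>x. x \<in> carrier_vec m \<Longrightarrow> quad_form Y x \<ge> 0"
      and Y1: "mat_inner (ones_mat m) Y = 1"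
      using Y by (auto simp: DN_feasible_def DN_def psd_mats_def nonneg_mats_def sym_mats_def)
    have Ysym: "Y $$ (i,j) = Y $$ (j,i)" if "i < m" "j < m" for i j
      using that Yc Yt by (metis carrier_matD index_transpose_mat(1))
    define h where "h = (\<lambda>(i,j). if i < m \<and> j < m then Y $$ (i,j) else 0)"
    have hnn: "h p \<ge> 0" for p using Yn by (auto simp: h_def split: prod.splits)
    have s: "(\<Sum>i<m. \<Sum>j<m. h (i,j)) = 1"
      using Y1 by (simp add: h_def mat_inner_def ones_mat_def)
    have h1: "h (i,j) \<le> 1" for i j
    proof (cases "i < m \<and> j < m")
      case True
      then have "h (i,j) \<le> (\<Sum>j<m. h (i,j))" using hnn by (intro member_le_sum) auto
      also have "\<dots> \<le> (\<Sum>i<m. \<Sum>j<m. h (i,j))"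
        using True hnn by (intro member_le_sum[of i "{..<m}" "\<lambda>i. \<Sum>j<m. h (i,j)"] sum_nonneg) auto
      finally show ?thesis using s by simp
    qed (auto simp: h_def)
    have hpsd: "0 \<le> (\<Sum>i<m. \<Sum>j<m. x i * (h (i,j) * x j))" for x
      using Yp[of "Matrix.vec m x"] by (simp add: quad_form_eq[OF Yc] h_def)
    have "h \<in> ?C" "h \<in> ?T" "h \<in> ?P" using hnn h1 s hpsd by auto
    moreover have "h \<in> ?S" using Ysym by (auto simp: h_def)
    ultimately have "h \<in> K" unfolding K_def by blast
    moreover have "mat_inner M Y = f h" by (simp add: mat_inner_def dim f_def h_def)
    ultimately show ?thesis using g(2) fX by simp
  qed
  have "ell M = mat_inner M X" unfolding ell_def dim
    by (rule cInf_eq_minimum) (use X min in auto)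
  then show ?thesis using X min by blast
qed

end

theory Submission
  imports Defs
begin

text \<open>
Everything rests on conic duality: the cone of doubly nonnegative matrices is dual to the closed
cone \<open>SPN\<close>, so a number \<open>a\<close> is a lower bound for \<open>ell M\<close> exactly if \<open>M - a E\<close> is in \<open>SPN\<close>,
that is, if \<open>M - a E\<close> dominates some positive semidefinite matrix entrywise (\<open>le_ell_iff\<close>).

Two inequalities hold for every symmetric \<open>Q\<close>. A positive semidefinite minorant of \<open>Q - a E\<close>
restricts to principal submatrices, so \<open>ell Q\<close> is at most every clique bound
(\<open>ell_le_ell_principal_submatrix\<close>). And the standard quadratic program has a minimiser supported on
a clique: if \<open>i\<close> and \<open>j\<close> are not adjacent, the form is concave along \<open>e\<^sub>i - e\<^sub>j\<close>, so mass can
be shifted between \<open>i\<close> and \<open>j\<close> until one of them leaves the support without raising the value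
(\<open>simplex_descent_to_clique\<close>). Hence the least clique bound is at most \<open>nu Q\<close>
(\<open>exists_maximal_clique_ell_le_nu\<close>).

Completability gives the reverse of the first inequality (\<open>clique_bound_le_ell\<close>). Let \<open>a\<close> be at
most every clique bound. By duality, \<open>Q - a E\<close> restricted to the diagonal and the edges is a partial
\<open>SPN\<close> matrix; let \<open>P\<close> be a positive semidefinite matrix below a completion of it. On the specified
entries \<open>P\<close> is below \<open>Q - a E\<close>. At a non-edge, semidefiniteness gives
\<open>2 P\<^sub>i\<^sub>j \<le> P\<^sub>i\<^sub>i + P\<^sub>j\<^sub>j \<le> (Q\<^sub>i\<^sub>i - a) + (Q\<^sub>j\<^sub>j - a) \<le> 2 (Q\<^sub>i\<^sub>j - a)\<close>,
the last step being the definition of a non-edge. So \<open>P\<close> is below \<open>Q - a E\<close> everywhere, whatever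
values the completion has chosen, and \<open>a \<le> ell Q\<close>.

Thus for a completable convexity graph the least clique bound equals \<open>ell Q\<close>, and the equivalence
is immediate.
\<close>

section \<open>Quadratic forms on a finite index set\<close>

text \<open>Matrices are handled as functions on an arbitrary finite index set, so that a principal submatrix is
the same function on a smaller set and no renumbering of rows and columns is needed.\<close>

definition bilin :: "'a set \<Rightarrow> ('a \<Rightarrow> 'a \<Rightarrow> real) \<Rightarrow> ('a \<Rightarrow> real) \<Rightarrow> ('a \<Rightarrow> real) \<Rightarrow> real" where
  "bilin C A x y = (\<Sum>i\<in>C. \<Sum>j\<in>C. x i * (A i j * y j))"

definition frob :: "'a set \<Rightarrow> ('a \<Rightarrow> 'a \<Rightarrow> real) \<Rightarrow> ('a \<Rightarrow> 'a \<Rightarrow> real) \<Rightarrow> real" where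
  "frob C A B = (\<Sum>i\<in>C. \<Sum>j\<in>C. A i j * B i j)"

definition symmetric_on :: "'a set \<Rightarrow> ('a \<Rightarrow> 'a \<Rightarrow> real) \<Rightarrow> bool" where
  "symmetric_on C A \<longleftrightarrow> (\<forall>i\<in>C. \<forall>j\<in>C. A i j = A j i)"

definition psd_on :: "'a set \<Rightarrow> ('a \<Rightarrow> 'a \<Rightarrow> real) \<Rightarrow> bool" where
  "psd_on C A \<longleftrightarrow> symmetric_on C A \<and> (\<forall>x. 0 \<le> bilin C A x x)"

definition DN_on :: "'a set \<Rightarrow> ('a \<Rightarrow> 'a \<Rightarrow> real) \<Rightarrow> bool" where
  "DN_on C A \<longleftrightarrow> psd_on C A \<and> (\<forall>i\<in>C. \<forall>j\<in>C. 0 \<le> A i j)"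

abbreviation unit_fun :: "'a \<Rightarrow> 'a \<Rightarrow> real" where
  "unit_fun k \<equiv> \<lambda>i. of_bool (i = k)"

lemma bilin_commute:
  assumes "symmetric_on C A"
  shows "bilin C A x y = bilin C A y x"
  unfolding bilin_def
  by (subst sum.swap, intro sum.cong refl) (use assms in \<open>auto simp: symmetric_on_def\<close>)

lemma bilin_add_scaled:
  assumes "symmetric_on C A"
  shows "bilin C A (\<lambda>i. x i + t * y i) (\<lambda>i. x i + t * y i) =
    bilin C A x x + 2 * t * bilin C A x y + t\<^sup>2 * bilin C A y y"
proof -
  have "bilin C A (\<lambda>i. x i + t * y i) (\<lambda>i. x i + t * y i) =
    bilin C A x x + t * bilin C A x y + t * bilin C A y x + t\<^sup>2 * bilin C A y y"
    unfolding bilin_def sum_distrib_left sum.distrib[symmetric]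
    by (intro sum.cong refl) (simp add: algebra_simps power2_eq_square)
  then show ?thesis using bilin_commute[OF assms, of y x] by simp
qed

lemma bilin_unit_right:
  assumes "finite C" "k \<in> C"
  shows "bilin C A x (unit_fun k) = (\<Sum>i\<in>C. x i * A i k)"
  using assms by (simp add: bilin_def of_bool_def mult_ac if_distrib cong: if_cong)

lemma bilin_unit_unit:
  assumes "finite C" "i \<in> C" "k \<in> C"
  shows "bilin C A (unit_fun i) (unit_fun k) = A i k"
  unfolding bilin_unit_right[OF assms(1,3)]
  using assms by (simp add: of_bool_def if_distrib if_distribR cong: if_cong)

lemma bilin_eq_frob: "bilin C A x x = frob C A (\<lambda>i j. x i * x j)"
  unfolding bilin_def frob_def by (intro sum.cong refl) simp

lemma psd_on_diag_nonneg:
  assumes "psd_on C A" "finite C" "i \<in> C"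
  shows "0 \<le> A i i"
proof -
  have "0 \<le> bilin C A (unit_fun i) (unit_fun i)" using assms(1) unfolding psd_on_def by blast
  then show ?thesis using assms by (simp only: bilin_unit_unit)
qed

text \<open>Evaluate the form at the vectors \<open>e\<^sub>i + e\<^sub>j\<close> and \<open>e\<^sub>i - e\<^sub>j\<close>.\<close>

lemma psd_on_entry_le:
  assumes "psd_on C A" "finite C" "i \<in> C" "j \<in> C"
  shows "2 * \<bar>A i j\<bar> \<le> A i i + A j j"
proof -
  have s: "symmetric_on C A" and p: "\<And>x. 0 \<le> bilin C A x x" using assms unfolding psd_on_def by auto
  have "0 \<le> A i i + 2 * t * A i j + t\<^sup>2 * A j j" for t
    using p[of "\<lambda>l. unit_fun i l + t * unit_fun j l"] unfolding bilin_add_scaled[OF s]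
    using assms by (simp only: bilin_unit_unit)
  from this[of 1] this[of "-1"] show ?thesis by simp
qed

lemma psd_on_subset:
  assumes "psd_on C A" "D \<subseteq> C" "finite C"
  shows "psd_on D A"
proof -
  have "bilin C A (\<lambda>i. if i \<in> D then x i else 0) (\<lambda>i. if i \<in> D then x i else 0) = bilin D A x x" for x
    unfolding bilin_def using assms(2,3)
    by (intro sum.mono_neutral_cong_right) (auto intro!: sum.mono_neutral_cong_right)
  then show ?thesis using assms unfolding psd_on_def symmetric_on_def by (metis subsetD)
qed

lemma psd_on_rank_one: "psd_on C (\<lambda>i j. v i * v j)"
proof -
  have "bilin C (\<lambda>i j. v i * v j) x x = (\<Sum>i\<in>C. v i * x i)\<^sup>2" for x
    unfolding bilin_def power2_eq_square sum_product by (intro sum.cong refl) simp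
  then show ?thesis unfolding psd_on_def symmetric_on_def by simp
qed

lemma psd_on_add_scaled:
  assumes "psd_on C A" "psd_on C B" "0 \<le> t"
  shows "psd_on C (\<lambda>i j. A i j + t * B i j)"
proof -
  have "bilin C (\<lambda>i j. A i j + t * B i j) x x = bilin C A x x + t * bilin C B x x" for x
    unfolding bilin_def sum_distrib_left sum.distrib[symmetric]
    by (intro sum.cong refl) (simp add: algebra_simps)
  then show ?thesis using assms unfolding psd_on_def symmetric_on_def by auto
qed

lemma psd_on_scale:
  assumes "psd_on C A" "0 \<le> t"
  shows "psd_on C (\<lambda>i j. t * A i j)"
  using psd_on_add_scaled[OF _ assms, of "\<lambda>_ _. 0"]
  by (simp add: psd_on_def symmetric_on_def bilin_def)

section \<open>The inner product of two positive semidefinite matrices\<close>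

text \<open>One step of a Cholesky factorisation. The Schur complement has at \<open>x\<close> the value of the original
form at \<open>x - s e\<^sub>k\<close>, where \<open>s\<close> is chosen to make that value least.\<close>

lemma psd_on_eliminate:
  assumes X: "psd_on C X" and fin: "finite C" and k: "k \<in> C" "0 < X k k"
  shows "psd_on C (\<lambda>i j. X i j - X i k * X j k / X k k)"
proof -
  have s: "symmetric_on C X" and p: "\<And>x. 0 \<le> bilin C X x x" using X unfolding psd_on_def by auto
  have "0 \<le> bilin C (\<lambda>i j. X i j - X i k * X j k / X k k) x x" for x
  proof -
    define b where "b = (\<Sum>i\<in>C. x i * X i k)"
    have "bilin C (\<lambda>i j. X i j - X i k * X j k / X k k) x x
        = bilin C X x x - (\<Sum>i\<in>C. \<Sum>j\<in>C. (x i * X i k) * (x j * X j k) / X k k)"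
      unfolding bilin_def sum_subtractf[symmetric]
      by (intro sum.cong refl) (simp add: algebra_simps)
    also have "(\<Sum>i\<in>C. \<Sum>j\<in>C. (x i * X i k) * (x j * X j k) / X k k) = b * b / X k k"
      by (simp add: b_def sum_product sum_divide_distrib)
    also have "bilin C X x x - b * b / X k k
        = bilin C X (\<lambda>i. x i + (- b / X k k) * unit_fun k i) (\<lambda>i. x i + (- b / X k k) * unit_fun k i)"
      unfolding bilin_add_scaled[OF s] bilin_unit_right[OF fin k(1), of X x, folded b_def]
        bilin_unit_unit[OF fin k(1) k(1)]
      using k(2) by (simp add: field_simps power2_eq_square)
    finally show ?thesis using p by simp
  qed
  then show ?thesis using s unfolding psd_on_def symmetric_on_def by (auto simp: mult.commute)
qed

text \<open>Subtracting from \<open>X\<close> the rank-one matrix of an elimination step lowers the inner product by a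
nonnegative multiple of a value of the form \<open>P\<close>, and it lowers the number of nonzero diagonal
entries of \<open>X\<close>. When none is left, \<open>X\<close> vanishes.\<close>

lemma frob_psd_nonneg:
  assumes P: "psd_on C P" and X: "psd_on C X" and fin: "finite C"
  shows "0 \<le> frob C P X"
  using X
proof (induction "card {i\<in>C. X i i \<noteq> 0}" arbitrary: X rule: less_induct)
  case less
  show ?case
  proof (cases "\<exists>k\<in>C. X k k \<noteq> 0")
    case False
    then have "X i j = 0" if "i \<in> C" "j \<in> C" for i j
      using psd_on_entry_le[OF less.prems fin that] that by simp
    then show ?thesis unfolding frob_def by simp
  next
    case True
    then obtain k where k: "k \<in> C" "X k k \<noteq> 0" by blast
    then have pos: "0 < X k k" using psd_on_diag_nonneg[OF less.prems fin k(1)] by simp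
    define X' where "X' i j = X i j - X i k * X j k / X k k" for i j
    have X': "psd_on C X'" unfolding X'_def by (rule psd_on_eliminate[OF less.prems fin k(1) pos])
    \<comment> \<open>The step can only decrease a diagonal entry, and the result stays nonnegative.\<close>
    have "X' i i = 0" if "i \<in> C" "X i i = 0" for i
    proof -
      have "X' i i \<le> 0" using that pos by (simp add: X'_def)
      then show ?thesis using psd_on_diag_nonneg[OF X' fin that(1)] by simp
    qed
    moreover have "X' k k = 0" using k by (simp add: X'_def)
    ultimately have "{i\<in>C. X' i i \<noteq> 0} \<subset> {i\<in>C. X i i \<noteq> 0}" using k by blast
    then have "card {i\<in>C. X' i i \<noteq> 0} < card {i\<in>C. X i i \<noteq> 0}"
      by (intro psubset_card_mono) (use fin in auto)
    then have "0 \<le> frob C P X'" using less.hyps X' by blast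
    moreover have "frob C P X = frob C P X' + bilin C P (\<lambda>i. X i k) (\<lambda>i. X i k) / X k k"
      unfolding bilin_eq_frob frob_def sum_divide_distrib sum.distrib[symmetric]
      by (intro sum.cong refl) (simp add: X'_def algebra_simps)
    moreover have "0 \<le> bilin C P (\<lambda>i. X i k) (\<lambda>i. X i k) / X k k"
      using P pos unfolding psd_on_def by simp
    ultimately show ?thesis by simp
  qed
qed

section \<open>Duality between DN and SPN\<close>

lemma compact_symmetric_cube: "compact {g :: 'a \<Rightarrow> real. \<forall>p. \<bar>g p\<bar> \<le> R}"
proof -
  have "compactin (product_topology (\<lambda>_. euclidean) UNIV) (PiE UNIV (\<lambda>_::'a. {-R..R}))"
    by (simp add: compactin_PiE)
  moreover have "PiE UNIV (\<lambda>_::'a. {-R..R}) = {g. \<forall>p. \<bar>g p\<bar> \<le> R}"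
    by (auto simp: PiE_def abs_le_iff minus_le_iff)
  ultimately show ?thesis by (simp add: euclidean_product_topology)
qed

text \<open>The squared distance of \<open>M - P\<close> to the cone of entrywise nonnegative matrices.\<close>

definition excess :: "'a set \<Rightarrow> ('a \<Rightarrow> 'a \<Rightarrow> real) \<Rightarrow> ('a \<Rightarrow> 'a \<Rightarrow> real) \<Rightarrow> real" where
  "excess C M P = (\<Sum>i\<in>C. \<Sum>j\<in>C. (max 0 (P i j - M i j))\<^sup>2)"

text \<open>A matrix whose excess is below that of zero has its diagonal bounded above in terms of \<open>M\<close>. For a
positive semidefinite matrix this bounds all entries, so the minimum may be sought in a compact
cube.\<close>

lemma excess_attains_minimum:
  fixes C :: "'a set"
  assumes fin: "finite C"
  shows "\<exists>P. psd_on C P \<and> (\<forall>P'. psd_on C P' \<longrightarrow> excess C M P \<le> excess C M P')"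
proof -
  \<comment> \<open>The zero matrix, the competitor that yields the size \<open>R\<close> of the cube.\<close>
  define Z where "Z = (\<lambda>(_ :: 'a) (_ :: 'a). 0 :: real)"
  define R where "R = (\<Sum>i\<in>C. \<bar>M i i\<bar>) + sqrt (excess C M Z)"
  have exc0: "0 \<le> excess C M P" for P unfolding excess_def by (intro sum_nonneg) auto
  have R0: "0 \<le> R" unfolding R_def using exc0 by (intro add_nonneg_nonneg sum_nonneg) auto
  define K where "K = {g :: 'a \<times> 'a \<Rightarrow> real. \<forall>p. \<bar>g p\<bar> \<le> R} \<inter> ({g. \<forall>i. \<forall>j. g (i,j) = g (j,i)} \<inter>
    {g. \<forall>x. 0 \<le> (\<Sum>i\<in>C. \<Sum>j\<in>C. x i * (g (i,j) * x j))})"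
  have comp: "compact K" unfolding K_def
    by (intro compact_Int_closed compact_symmetric_cube closed_Int closed_Collect_all closed_Collect_eq
        closed_Collect_le continuous_on_sum continuous_on_mult continuous_on_const
        continuous_on_coordinate)
  have ZK: "(\<lambda>_. 0) \<in> K" using R0 by (auto simp: K_def)
  have "continuous_on K (\<lambda>g. excess C M (\<lambda>i j. g (i,j)))"
    unfolding excess_def
    by (intro continuous_on_sum continuous_on_power continuous_on_max continuous_on_diff
        continuous_on_const continuous_on_coordinate)
  from continuous_attains_inf[OF comp _ this] ZK obtain g where g: "g \<in> K"
    and min: "\<And>h. h \<in> K \<Longrightarrow> excess C M (\<lambda>i j. g (i,j)) \<le> excess C M (\<lambda>i j. h (i,j))" by blast
  have psd: "psd_on C (\<lambda>i j. g (i,j))"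
    using g unfolding K_def psd_on_def symmetric_on_def bilin_def by blast
  have "excess C M (\<lambda>i j. g (i,j)) \<le> excess C M P" if P: "psd_on C P" for P
  proof (cases "excess C M Z \<le> excess C M P")
    case True
    then show ?thesis using min[OF ZK] by (simp add: Z_def)
  next
    case False
    have diag: "P i i \<le> R" if i: "i \<in> C" for i
    proof -
      have "(max 0 (P i i - M i i))\<^sup>2 \<le> (\<Sum>j\<in>C. (max 0 (P i j - M i j))\<^sup>2)"
        using i fin by (intro member_le_sum) auto
      also have "\<dots> \<le> excess C M P" unfolding excess_def
        using i fin by (intro member_le_sum[of i C "\<lambda>i. \<Sum>j\<in>C. (max 0 (P i j - M i j))\<^sup>2"] sum_nonneg) auto
      finally have "(max 0 (P i i - M i i))\<^sup>2 \<le> excess C M Z" using False by simp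
      then have "max 0 (P i i - M i i) \<le> sqrt (excess C M Z)" by (rule real_le_rsqrt)
      moreover have "\<bar>M i i\<bar> \<le> (\<Sum>i\<in>C. \<bar>M i i\<bar>)" using i fin by (intro member_le_sum) auto
      ultimately show ?thesis unfolding R_def by linarith
    qed
    define h where "h = (\<lambda>(i,j). if i \<in> C \<and> j \<in> C then P i j else 0)"
    have "\<bar>P i j\<bar> \<le> R" if "i \<in> C" "j \<in> C" for i j
      using psd_on_entry_le[OF P fin that] diag[OF that(1)] diag[OF that(2)] by linarith
    moreover have "(\<Sum>i\<in>C. \<Sum>j\<in>C. x i * (h (i,j) * x j)) = bilin C P x x" for x
      unfolding bilin_def h_def by (intro sum.cong refl) auto
    ultimately have "h \<in> K" using P R0 unfolding K_def h_def psd_on_def symmetric_on_def by auto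
    moreover have "excess C M (\<lambda>i j. h (i,j)) = excess C M P"
      unfolding excess_def h_def by (intro sum.cong refl) auto
    ultimately show ?thesis using min by metis
  qed
  then show ?thesis using psd by blast
qed

text \<open>A one-sided second-order expansion, used instead of differentiating the excess. It holds entrywise
because \<open>max 0 (a + h)\<close> is at most the absolute value of \<open>max 0 a + h\<close>.\<close>

lemma excess_perturb_le:
  "excess C M (\<lambda>i j. P i j + t * D i j)
   \<le> excess C M P + 2 * t * frob C (\<lambda>i j. max 0 (P i j - M i j)) D + t\<^sup>2 * frob C D D"
proof -
  have scalar: "(max 0 (a + h))\<^sup>2 \<le> (max 0 a)\<^sup>2 + 2 * max 0 a * h + h\<^sup>2" for a h :: real
  proof -
    have "(max 0 (a + h))\<^sup>2 \<le> (max 0 a + h)\<^sup>2"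
      by (rule abs_le_square_iff[THEN iffD1]) (auto simp: max_def)
    then show ?thesis by (simp add: power2_sum algebra_simps)
  qed
  have "excess C M (\<lambda>i j. P i j + t * D i j)
    \<le> (\<Sum>i\<in>C. \<Sum>j\<in>C. (max 0 (P i j - M i j))\<^sup>2 + 2 * t * (max 0 (P i j - M i j) * D i j)
        + t\<^sup>2 * (D i j * D i j))"
    unfolding excess_def
  proof (intro sum_mono)
    fix i j
    show "(max 0 (P i j + t * D i j - M i j))\<^sup>2
      \<le> (max 0 (P i j - M i j))\<^sup>2 + 2 * t * (max 0 (P i j - M i j) * D i j) + t\<^sup>2 * (D i j * D i j)"
      using scalar[of "P i j - M i j" "t * D i j"] by (simp add: algebra_simps power2_eq_square)
  qed
  also have "\<dots> = excess C M P + 2 * t * frob C (\<lambda>i j. max 0 (P i j - M i j)) D + t\<^sup>2 * frob C D D"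
    by (simp add: excess_def frob_def sum.distrib sum_distrib_left)
  finally show ?thesis .
qed

lemma nonneg_if_first_order_nonneg:
  fixes a b :: real
  assumes "\<And>t. 0 < t \<Longrightarrow> t < 1 \<Longrightarrow> 0 \<le> 2 * t * a + t\<^sup>2 * b"
  shows "0 \<le> a"
proof (rule tendsto_lowerbound)
  show "((\<lambda>t. a + t * b / 2) \<longlongrightarrow> a) (at_right 0)" by (auto intro!: tendsto_eq_intros)
  have "0 \<le> a + t * b / 2" if "t \<in> {0<..<1}" for t
  proof -
    have "0 \<le> 2 * t * (a + t * b / 2)"
      using assms[of t] that by (simp add: algebra_simps power2_eq_square)
    then show ?thesis using that by (simp add: zero_le_mult_iff)
  qed
  then show "\<forall>\<^sub>F t in at_right 0. 0 \<le> a + t * b / 2"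
    by (intro eventually_mono[OF eventually_at_right_real[of 0 1]]) auto
qed simp

text \<open>Choose the positive semidefinite \<open>P\<close> that brings \<open>M - P\<close> closest to the nonnegative cone, and let
\<open>Y\<close> be the positive part of \<open>P - M\<close>. Varying \<open>P\<close> by rank-one matrices shows that \<open>Y\<close> is
positive semidefinite, hence doubly nonnegative; shrinking \<open>P\<close> shows \<open>\<langle>Y, P\<rangle> \<le> 0\<close>. Then
\<open>\<langle>Y, Y\<rangle> = \<langle>Y, P\<rangle> - \<langle>M, Y\<rangle> \<le> 0\<close>, so \<open>Y\<close> vanishes and \<open>P\<close> lies below \<open>M\<close>. Only \<open>P\<close>
is optimised over: the best nonnegative summand for a given \<open>P\<close> is explicit, so the closedness of
the sum of the two cones never has to be shown separately.\<close>

theorem DN_dual_is_SPN: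
  assumes fin: "finite C" and sym: "symmetric_on C M"
    and dual: "\<And>X. DN_on C X \<Longrightarrow> 0 \<le> frob C M X"
  shows "\<exists>P. psd_on C P \<and> (\<forall>i\<in>C. \<forall>j\<in>C. P i j \<le> M i j)"
proof -
  obtain P where P: "psd_on C P"
    and min: "\<And>P'. psd_on C P' \<Longrightarrow> excess C M P \<le> excess C M P'"
    using excess_attains_minimum[OF fin, of M] by blast
  define Y where "Y i j = max 0 (P i j - M i j)" for i j
  have variation: "0 \<le> frob C Y D"
    if "\<And>t. 0 < t \<Longrightarrow> t < 1 \<Longrightarrow> psd_on C (\<lambda>i j. P i j + t * D i j)" for D
  proof (rule nonneg_if_first_order_nonneg)
    fix t :: real assume "0 < t" "t < 1"
    then show "0 \<le> 2 * t * frob C Y D + t\<^sup>2 * frob C D D"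
      using min[OF that[of t]] excess_perturb_le[of C M P t D] unfolding Y_def by linarith
  qed
  have "0 \<le> bilin C Y x x" for x
    unfolding bilin_eq_frob by (intro variation psd_on_add_scaled P psd_on_rank_one) simp
  moreover have "symmetric_on C Y"
    using P sym unfolding psd_on_def symmetric_on_def Y_def by simp
  ultimately have Y: "DN_on C Y" unfolding DN_on_def psd_on_def Y_def by simp
  have "0 \<le> frob C Y (\<lambda>i j. - P i j)"
  proof (rule variation)
    fix t :: real assume "0 < t" "t < 1"
    then show "psd_on C (\<lambda>i j. P i j + t * - P i j)"
      using psd_on_scale[OF P, of "1 - t"] by (simp add: algebra_simps)
  qed
  then have YP: "0 \<le> - frob C Y P" by (simp add: frob_def sum_negf)
  \<comment> \<open>Where \<open>Y\<close> is nonzero it equals \<open>P - M\<close>.\<close>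
  have "frob C Y Y = frob C Y P - frob C M Y"
    unfolding frob_def sum_subtractf[symmetric]
    by (intro sum.cong refl) (auto simp: Y_def max_def algebra_simps)
  then have "frob C Y Y \<le> 0" using YP dual[OF Y] by simp
  moreover have "Y i j * Y i j \<le> frob C Y Y" if "i \<in> C" "j \<in> C" for i j
  proof -
    have "Y i j * Y i j \<le> (\<Sum>j\<in>C. Y i j * Y i j)"
      using that fin by (intro member_le_sum[of j C "\<lambda>j. Y i j * Y i j"]) auto
    also have "\<dots> \<le> frob C Y Y" unfolding frob_def
      using that fin by (intro member_le_sum[of i C "\<lambda>i. \<Sum>j\<in>C. Y i j * Y i j"] sum_nonneg) auto
    finally show ?thesis .
  qed
  ultimately have "Y i j = 0" if "i \<in> C" "j \<in> C" for i j
    using that by (smt (verit) mult_eq_0_iff zero_le_square)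
  then have "P i j \<le> M i j" if "i \<in> C" "j \<in> C" for i j
    using that unfolding Y_def by (smt (verit))
  then show ?thesis using P by blast
qed

section \<open>Real matrices as functions on an index set\<close>

text \<open>The link between matrices indexed by \<open>{..<m}\<close> and functions on an index set: both \<open>Q\<close> itself (with
the identity) and its principal submatrices (with the increasing enumeration \<open>pick C\<close>) are of this
form, so one set of lemmas serves for both.\<close>

definition enumerates :: "(nat \<Rightarrow> 'a) \<Rightarrow> nat \<Rightarrow> 'a set \<Rightarrow> ('a \<Rightarrow> 'a \<Rightarrow> real) \<Rightarrow> real mat \<Rightarrow> bool" where
  "enumerates h m C q M \<longleftrightarrow> M \<in> carrier_mat m m \<and> bij_betw h {..<m} C \<and>
     (\<forall>i<m. \<forall>j<m. M $$ (i,j) = q (h i) (h j))"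

abbreviation entries :: "real mat \<Rightarrow> nat \<Rightarrow> nat \<Rightarrow> real" where
  "entries M \<equiv> \<lambda>i j. M $$ (i,j)"

lemma enumerates_id: "M \<in> carrier_mat m m \<Longrightarrow> enumerates id m {..<m} (entries M) M"
  by (auto simp: enumerates_def)

lemma enumerates_mat:
  "bij_betw h {..<m} C \<Longrightarrow> enumerates h m C q (Matrix.mat m m (\<lambda>(i,j). q (h i) (h j)))"
  by (auto simp: enumerates_def)

lemma bij_betw_pick:
  assumes "finite C"
  shows "bij_betw (pick C) {..<card C} C"
proof -
  have "C \<subseteq> pick C ` {..<card C}"
  proof
    fix i assume i: "i \<in> C"
    then have "{a\<in>C. a < i} \<subset> C" by auto
    then have "card {a\<in>C. a < i} < card C" using assms by (rule psubset_card_mono[rotated])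
    then show "i \<in> pick C ` {..<card C}" using pick_card_in_set[OF i] by force
  qed
  moreover have "pick C ` {..<card C} \<subseteq> C" using pick_in_set_le by blast
  ultimately have "pick C ` {..<card C} = C" by simp
  then show ?thesis unfolding bij_betw_def by (simp add: eq_card_imp_inj_on)
qed

lemma principal_submatrix_index:
  assumes "M \<in> carrier_mat n n" "C \<subseteq> {..<n}" "i < card C" "j < card C"
  shows "principal_submatrix M C $$ (i,j) = M $$ (pick C i, pick C j)"
proof -
  have "{a. a < n \<and> a \<in> C} = C" using assms(2) by auto
  then show ?thesis using assms by (intro submatrix_index) auto
qed

lemma enumerates_principal_submatrix:
  assumes "M \<in> carrier_mat n n" "C \<subseteq> {..<n}"
  shows "enumerates (pick C) (card C) C (entries M) (principal_submatrix M C)"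
  unfolding enumerates_def
  using assms by (auto simp: principal_submatrix_index dim_principal_submatrix
      intro: bij_betw_pick finite_subset)

lemma enumerates_symmetric:
  assumes "enumerates h m C q M"
  shows "M \<in> sym_mats m \<longleftrightarrow> symmetric_on C q"
proof -
  have M: "M \<in> carrier_mat m m" and im: "C = h ` {..<m}"
    and e: "\<And>i j. i < m \<Longrightarrow> j < m \<Longrightarrow> M $$ (i,j) = q (h i) (h j)"
    using assms unfolding enumerates_def bij_betw_def by auto
  have "transpose_mat M = M \<longleftrightarrow> (\<forall>i<m. \<forall>j<m. M $$ (i,j) = M $$ (j,i))"
    using M by (auto simp: mat_eq_iff)
  then show ?thesis using M e unfolding sym_mats_def im symmetric_on_def by auto
qed

lemma enumerates_bilin:
  assumes "enumerates h m C q M"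
  shows "quad_form M (Matrix.vec m (\<lambda>i. x (h i))) = bilin C q x x"
proof -
  have M: "M \<in> carrier_mat m m" and bij: "bij_betw h {..<m} C"
    and e: "\<And>i j. i < m \<Longrightarrow> j < m \<Longrightarrow> M $$ (i,j) = q (h i) (h j)"
    using assms unfolding enumerates_def by auto
  show ?thesis
    unfolding bilin_def sum.reindex_bij_betw[OF bij, symmetric]
    by (subst quad_form_eq[OF M]) (auto simp: e intro!: sum.cong)
qed

lemma enumerates_frob:
  assumes "enumerates h m C q M" "enumerates h m C r X"
  shows "mat_inner M X = frob C q r"
proof -
  have bij: "bij_betw h {..<m} C" using assms unfolding enumerates_def by auto
  show ?thesis
    unfolding frob_def sum.reindex_bij_betw[OF bij, symmetric]
    using assms by (auto simp: mat_inner_def enumerates_def)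
qed

lemma vec_as_pullback:
  assumes "bij_betw h {..<m} C" "v \<in> carrier_vec m"
  obtains x where "v = Matrix.vec m (\<lambda>i. x (h i))"
proof
  show "v = Matrix.vec m (\<lambda>i. vec_index v (inv_into {..<m} h (h i)))"
    using assms by (intro eq_vecI) (auto simp: bij_betw_def)
qed

lemma mat_as_pullback:
  assumes "bij_betw h {..<m} C" "X \<in> carrier_mat m m"
  shows "enumerates h m C (\<lambda>a b. X $$ (inv_into {..<m} h a, inv_into {..<m} h b)) X"
  using assms by (auto simp: enumerates_def bij_betw_def)

lemma enumerates_psd:
  assumes "enumerates h m C q M"
  shows "M \<in> psd_mats m \<longleftrightarrow> psd_on C q"
proof -
  have bij: "bij_betw h {..<m} C" using assms unfolding enumerates_def by auto
  have "(\<forall>v\<in>carrier_vec m. 0 \<le> quad_form M v) \<longleftrightarrow> (\<forall>x. 0 \<le> bilin C q x x)"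
  proof (intro iffI allI ballI)
    fix x assume "\<forall>v\<in>carrier_vec m. 0 \<le> quad_form M v"
    then show "0 \<le> bilin C q x x" using enumerates_bilin[OF assms, of x] by (metis vec_carrier)
  next
    fix v :: "real Matrix.vec" assume x: "\<forall>x. 0 \<le> bilin C q x x" and v: "v \<in> carrier_vec m"
    obtain x where "v = Matrix.vec m (\<lambda>i. x (h i))" by (rule vec_as_pullback[OF bij v])
    then show "0 \<le> quad_form M v" using x enumerates_bilin[OF assms] by simp
  qed
  then show ?thesis
    using enumerates_symmetric[OF assms] unfolding psd_mats_def psd_on_def by auto
qed

lemma enumerates_nonneg:
  assumes "enumerates h m C q M"
  shows "M \<in> nonneg_mats m \<longleftrightarrow> symmetric_on C q \<and> (\<forall>i\<in>C. \<forall>j\<in>C. 0 \<le> q i j)"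
proof -
  have "C = h ` {..<m}" using assms unfolding enumerates_def bij_betw_def by auto
  then show ?thesis
    using assms enumerates_symmetric[OF assms] unfolding nonneg_mats_def enumerates_def by auto
qed

lemma enumerates_DN:
  assumes "enumerates h m C q M"
  shows "M \<in> DN m \<longleftrightarrow> DN_on C q"
  using enumerates_psd[OF assms] enumerates_nonneg[OF assms]
  unfolding DN_def DN_on_def psd_on_def by auto

lemma enumerates_SPN:
  assumes M: "enumerates h m C q M" and sym: "symmetric_on C q"
  shows "M \<in> SPN m \<longleftrightarrow> (\<exists>P. psd_on C P \<and> (\<forall>i\<in>C. \<forall>j\<in>C. P i j \<le> q i j))"
proof
  have bij: "bij_betw h {..<m} C" and im: "C = h ` {..<m}"
    and e: "\<And>i j. i < m \<Longrightarrow> j < m \<Longrightarrow> M $$ (i,j) = q (h i) (h j)"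
    using M unfolding enumerates_def bij_betw_def by auto
  assume "M \<in> SPN m"
  then obtain P N where PN: "M = P + N" "P \<in> psd_mats m" "N \<in> nonneg_mats m"
    unfolding SPN_def by auto
  then have Pc: "P \<in> carrier_mat m m" and Nc: "N \<in> carrier_mat m m"
    and N0: "\<And>i j. i < m \<Longrightarrow> j < m \<Longrightarrow> 0 \<le> N $$ (i,j)"
    unfolding psd_mats_def nonneg_mats_def sym_mats_def by auto
  define p where "p a b = P $$ (inv_into {..<m} h a, inv_into {..<m} h b)" for a b
  have Pp: "enumerates h m C p P" unfolding p_def by (rule mat_as_pullback[OF bij Pc])
  have "psd_on C p" using enumerates_psd[OF Pp] PN(2) by simp
  moreover have "p (h i) (h j) \<le> q (h i) (h j)" if "i < m" "j < m" for i j
  proof -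
    have "p (h i) (h j) = P $$ (i,j)" using Pp that unfolding enumerates_def by auto
    moreover have "q (h i) (h j) = P $$ (i,j) + N $$ (i,j)"
      using e[OF that] PN(1) Pc Nc that by simp
    ultimately show ?thesis using N0[OF that] by simp
  qed
  ultimately show "\<exists>P. psd_on C P \<and> (\<forall>i\<in>C. \<forall>j\<in>C. P i j \<le> q i j)"
    unfolding im by blast
next
  have bij: "bij_betw h {..<m} C" and Mc: "M \<in> carrier_mat m m"
    and e: "\<And>i j. i < m \<Longrightarrow> j < m \<Longrightarrow> M $$ (i,j) = q (h i) (h j)"
    using M unfolding enumerates_def by auto
  assume "\<exists>P. psd_on C P \<and> (\<forall>i\<in>C. \<forall>j\<in>C. P i j \<le> q i j)"
  then obtain p where p: "psd_on C p" "\<And>i j. i \<in> C \<Longrightarrow> j \<in> C \<Longrightarrow> p i j \<le> q i j" by blast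
  define r where "r i j = q i j - p i j" for i j
  define P where "P = Matrix.mat m m (\<lambda>(i,j). p (h i) (h j))"
  define N where "N = Matrix.mat m m (\<lambda>(i,j). r (h i) (h j))"
  have P: "enumerates h m C p P" unfolding P_def by (rule enumerates_mat[OF bij])
  have N: "enumerates h m C r N" unfolding N_def by (rule enumerates_mat[OF bij])
  have "P \<in> psd_mats m" using enumerates_psd[OF P] p(1) by simp
  moreover have "N \<in> nonneg_mats m"
    using enumerates_nonneg[OF N] p sym unfolding r_def symmetric_on_def psd_on_def by simp
  moreover have "M = P + N" using Mc by (intro eq_matI) (auto simp: P_def N_def r_def e)
  ultimately show "M \<in> SPN m" unfolding SPN_def by blast
qed

section \<open>The doubly nonnegative bound\<close>

text \<open>Strong and weak duality for the doubly nonnegative program. For the first, the bound on normalised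
matrices extends to the whole cone by scaling; for the second, the inner product of two positive
semidefinite matrices is nonnegative.\<close>

theorem le_ell_iff:
  assumes M: "enumerates h m C q M" and sym: "symmetric_on C q" and ne: "C \<noteq> {}"
  shows "a \<le> ell M \<longleftrightarrow> (\<exists>P. psd_on C P \<and> (\<forall>i\<in>C. \<forall>j\<in>C. P i j \<le> q i j - a))"
proof -
  have bij: "bij_betw h {..<m} C" and Mc: "M \<in> carrier_mat m m"
    using M unfolding enumerates_def by auto
  have fin: "finite C" and pos: "0 < m"
    using bij_betw_finite[OF bij] bij ne by (auto simp: bij_betw_def intro: Nat.gr0I)
  have sm: "M \<in> sym_mats m" using enumerates_symmetric[OF M] sym by simp
  have ones: "enumerates h m C (\<lambda>_ _. 1) (ones_mat m)"
    using bij by (auto simp: enumerates_def ones_mat_def)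
  have shift: "frob C (\<lambda>i j. q i j - a) X = frob C q X - a * frob C (\<lambda>_ _. 1) X" for X
    unfolding frob_def sum_distrib_left sum_subtractf[symmetric]
    by (intro sum.cong refl) (simp add: algebra_simps)
  obtain X0 where X0: "X0 \<in> DN_feasible m" "ell M = mat_inner M X0"
    and min: "\<And>Y. Y \<in> DN_feasible m \<Longrightarrow> ell M \<le> mat_inner M Y"
    using ell_attained[OF sm pos] by metis
  show ?thesis
  proof
    assume a: "a \<le> ell M"
    show "\<exists>P. psd_on C P \<and> (\<forall>i\<in>C. \<forall>j\<in>C. P i j \<le> q i j - a)"
    proof (rule DN_dual_is_SPN[OF fin])
      show "symmetric_on C (\<lambda>i j. q i j - a)" using sym unfolding symmetric_on_def by simp
      fix X assume X: "DN_on C X"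
      define s where "s = frob C (\<lambda>_ _. 1) X"
      have X0: "\<And>i j. i \<in> C \<Longrightarrow> j \<in> C \<Longrightarrow> 0 \<le> X i j" using X unfolding DN_on_def by auto
      then have s0: "0 \<le> s" unfolding s_def frob_def by (intro sum_nonneg) auto
      show "0 \<le> frob C (\<lambda>i j. q i j - a) X"
      \<comment> \<open>A nonnegative matrix with entry sum zero cannot be normalised, but it is zero.\<close>
      proof (cases "s = 0")
        case True
        then have "\<forall>i\<in>C. (\<Sum>j\<in>C. X i j) = 0"
          unfolding s_def frob_def using X0 fin
          by (subst (asm) sum_nonneg_eq_0_iff) (auto intro!: sum_nonneg)
        then have "\<forall>i\<in>C. \<forall>j\<in>C. X i j = 0" using X0 fin by (simp add: sum_nonneg_eq_0_iff)
        then show ?thesis unfolding frob_def by simp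
      next
        case False
        then have s: "0 < s" using s0 by simp
        define Y where "Y i j = 1 / s * X i j" for i j
        have fY: "frob C r Y = frob C r X / s" for r
          unfolding frob_def Y_def sum_divide_distrib by simp
        define Z where "Z = Matrix.mat m m (\<lambda>(i,j). Y (h i) (h j))"
        have Z: "enumerates h m C Y Z" unfolding Z_def by (rule enumerates_mat[OF bij])
        have "DN_on C Y"
          using X s psd_on_scale[of C X "1 / s"] unfolding DN_on_def Y_def by auto
        then have "Z \<in> DN_feasible m"
          unfolding DN_feasible_def using enumerates_DN[OF Z] enumerates_frob[OF ones Z] s
          by (simp add: fY s_def)
        then have "a \<le> frob C q X / s" using min a enumerates_frob[OF M Z] fY by fastforce
        then have "a * s \<le> frob C q X" using s by (simp add: pos_le_divide_eq)
        then show ?thesis unfolding shift s_def by simp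
      qed
    qed
  next
    assume "\<exists>P. psd_on C P \<and> (\<forall>i\<in>C. \<forall>j\<in>C. P i j \<le> q i j - a)"
    then obtain P where P: "psd_on C P" "\<And>i j. i \<in> C \<Longrightarrow> j \<in> C \<Longrightarrow> P i j \<le> q i j - a" by blast
    define x where "x a b = X0 $$ (inv_into {..<m} h a, inv_into {..<m} h b)" for a b
    have "X0 \<in> carrier_mat m m"
      using X0 unfolding DN_feasible_def DN_def psd_mats_def sym_mats_def by auto
    then have x: "enumerates h m C x X0" unfolding x_def by (rule mat_as_pullback[OF bij])
    have DN: "DN_on C x" and one: "frob C (\<lambda>_ _. 1) x = 1"
      using X0 enumerates_DN[OF x] enumerates_frob[OF ones x] unfolding DN_feasible_def by auto
    have "0 \<le> frob C P x" using DN unfolding DN_on_def by (intro frob_psd_nonneg P fin) auto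
    also have "\<dots> \<le> frob C (\<lambda>i j. q i j - a) x"
      unfolding frob_def using P(2) DN unfolding DN_on_def by (intro sum_mono mult_right_mono) auto
    also have "\<dots> = ell M - a" unfolding shift one X0(2) enumerates_frob[OF M x] by simp
    finally show "a \<le> ell M" by simp
  qed
qed

definition simplex_on :: "'a set \<Rightarrow> ('a \<Rightarrow> real) set" where
  "simplex_on C = {x. (\<forall>i\<in>C. 0 \<le> x i) \<and> (\<Sum>i\<in>C. x i) = 1}"

text \<open>The rank-one matrix of a point of the simplex is feasible for the doubly nonnegative program. The
proof evaluates the form of an optimal dual solution at that point.\<close>

lemma ell_le_quadratic_form:
  assumes M: "enumerates h m C q M" and sym: "symmetric_on C q" and x: "x \<in> simplex_on C"
  shows "ell M \<le> bilin C q x x"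
proof -
  have "C \<noteq> {}" using x unfolding simplex_on_def by auto
  then obtain P where P: "psd_on C P" "\<And>i j. i \<in> C \<Longrightarrow> j \<in> C \<Longrightarrow> P i j \<le> q i j - ell M"
    using le_ell_iff[OF M sym, of "ell M"] by auto
  have "0 \<le> bilin C P x x" using P(1) unfolding psd_on_def by simp
  also have "\<dots> \<le> bilin C (\<lambda>i j. q i j - ell M) x x"
    unfolding bilin_def using P(2) x unfolding simplex_on_def
    by (intro sum_mono mult_left_mono mult_right_mono) auto
  also have "\<dots> = bilin C q x x - ell M * ((\<Sum>i\<in>C. x i) * (\<Sum>j\<in>C. x j))"
    unfolding bilin_def sum_product unfolding sum_distrib_left sum_subtractf[symmetric]
    by (intro sum.cong refl) (simp add: algebra_simps)
  also have "\<dots> = bilin C q x x - ell M" using x unfolding simplex_on_def by simp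
  finally show ?thesis by simp
qed

lemma nu_attained_on:
  assumes "Q \<in> sym_mats n" "0 < n"
  obtains x where "x \<in> simplex_on {..<n}" "nu Q = bilin {..<n} (entries Q) x x"
proof -
  have Q: "enumerates id n {..<n} (entries Q) Q"
    using assms(1) by (intro enumerates_id) (simp add: sym_mats_def)
  obtain v where v: "v \<in> std_simplex n" "nu Q = quad_form Q v" using nu_attained[OF assms] by blast
  have "v = Matrix.vec n (vec_index v)" using v(1) by (intro eq_vecI) (auto simp: std_simplex_def)
  then have "quad_form Q v = bilin {..<n} (entries Q) (vec_index v) (vec_index v)"
    using enumerates_bilin[OF Q, of "vec_index v"] by simp
  moreover have "vec_index v \<in> simplex_on {..<n}"
    using v(1) by (auto simp: std_simplex_def simplex_on_def ones_vec_def scalar_prod_def atLeast0LessThan)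
  ultimately show thesis using that v(2) by simp
qed

section \<open>Minimisers supported on cliques of the convexity graph\<close>

lemma concave_quadratic_endpoint:
  fixes a b u v :: real
  assumes "a \<le> 0" "0 \<le> u" "0 \<le> v"
  shows "2 * (- u) * b + (- u)\<^sup>2 * a \<le> 0 \<or> 2 * v * b + v\<^sup>2 * a \<le> 0"
proof -
  have "(- u)\<^sup>2 * a \<le> 0" "v\<^sup>2 * a \<le> 0" using assms(1) by (auto intro: mult_nonneg_nonpos)
  moreover have "u * b \<ge> 0 \<or> v * b \<le> 0"
    using assms(2,3) by (cases "0 \<le> b") (auto intro: mult_nonneg_nonneg mult_nonneg_nonpos)
  ultimately show ?thesis by auto
qed

text \<open>Two positions of the support that violate the strict inequality span a direction \<open>e\<^sub>i - e\<^sub>j\<close> of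
nonpositive curvature. Moving along it to a suitable one of the two boundary points does not raise
the form, and it removes \<open>i\<close> or \<open>j\<close> from the support.\<close>

lemma simplex_descent_to_clique:
  assumes fin: "finite C" and sym: "symmetric_on C A" and x: "x \<in> simplex_on C"
  shows "\<exists>y \<in> simplex_on C. bilin C A y y \<le> bilin C A x x \<and>
    (\<forall>i\<in>C. \<forall>j\<in>C. y i \<noteq> 0 \<and> y j \<noteq> 0 \<and> i \<noteq> j \<longrightarrow> 2 * A i j < A i i + A j j)"
  using x
proof (induction "card {i\<in>C. x i \<noteq> 0}" arbitrary: x rule: less_induct)
  case less
  show ?case
  proof (cases "\<exists>i\<in>C. \<exists>j\<in>C. x i \<noteq> 0 \<and> x j \<noteq> 0 \<and> i \<noteq> j \<and> A i i + A j j \<le> 2 * A i j")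
    case False
    then show ?thesis using less.prems by (intro bexI[of _ x]) (auto simp: not_le)
  next
    case True
    then obtain i j where ij: "i \<in> C" "j \<in> C" "x i \<noteq> 0" "x j \<noteq> 0" "i \<noteq> j"
      "A i i + A j j \<le> 2 * A i j" by blast
    have x0: "\<And>l. l \<in> C \<Longrightarrow> 0 \<le> x l" and x1: "(\<Sum>l\<in>C. x l) = 1"
      using less.prems unfolding simplex_on_def by auto
    define d where "d l = unit_fun i l + (- 1) * unit_fun j l" for l
    have curv: "bilin C A d d \<le> 0"
      unfolding d_def bilin_add_scaled[OF sym] bilin_unit_unit[OF fin ij(1) ij(1)]
        bilin_unit_unit[OF fin ij(1) ij(2)] bilin_unit_unit[OF fin ij(2) ij(2)]
      using ij(6) by simp
    obtain t where t: "t = - x i \<or> t = x j"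
      and dec: "2 * t * bilin C A x d + t\<^sup>2 * bilin C A d d \<le> 0"
      using concave_quadratic_endpoint[OF curv x0[OF ij(1)] x0[OF ij(2)], of "bilin C A x d"] by blast
    define y where "y l = x l + t * d l" for l
    have yi: "y i = x i + t" and yj: "y j = x j - t" and yl: "\<And>l. l \<noteq> i \<Longrightarrow> l \<noteq> j \<Longrightarrow> y l = x l"
      using ij(5) by (auto simp: y_def d_def)
    have y0: "0 \<le> y l" if "l \<in> C" for l
      using t x0[OF that] x0[OF ij(1)] x0[OF ij(2)] yi yj yl by (cases "l = i \<or> l = j") auto
    have "(\<Sum>l\<in>C. d l) = 0"
      unfolding d_def using fin ij by (simp add: sum_subtractf of_bool_def)
    then have "(\<Sum>l\<in>C. y l) = 1" using x1 by (simp add: y_def sum.distrib sum_distrib_left[symmetric])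
    then have y: "y \<in> simplex_on C" using y0 unfolding simplex_on_def by simp
    have "{l\<in>C. y l \<noteq> 0} \<subseteq> {l\<in>C. x l \<noteq> 0}" using yl ij by force
    moreover have "y i = 0 \<or> y j = 0" using t yi yj by auto
    ultimately have "{l\<in>C. y l \<noteq> 0} \<subset> {l\<in>C. x l \<noteq> 0}" using ij by blast
    then have "card {l\<in>C. y l \<noteq> 0} < card {l\<in>C. x l \<noteq> 0}"
      by (intro psubset_card_mono) (use fin in auto)
    from less.hyps[OF this y] obtain z where z: "z \<in> simplex_on C"
      "bilin C A z z \<le> bilin C A y y"
      "\<forall>i\<in>C. \<forall>j\<in>C. z i \<noteq> 0 \<and> z j \<noteq> 0 \<and> i \<noteq> j \<longrightarrow> 2 * A i j < A i i + A j j" by blast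
    moreover have "bilin C A y y \<le> bilin C A x x"
      unfolding y_def bilin_add_scaled[OF sym] using dec by simp
    ultimately show ?thesis by (intro bexI[of _ z]) auto
  qed
qed

lemma convexity_graph_edge_iff:
  assumes Q: "Q \<in> sym_mats n" and ij: "i < n" "j < n" "i \<noteq> j"
  shows "{i,j} \<in> convexity_graph Q \<longleftrightarrow> 2 * Q $$ (i,j) < Q $$ (i,i) + Q $$ (j,j)"
proof -
  have dim: "dim_row Q = n" and sym: "Q $$ (j,i) = Q $$ (i,j)"
    using Q ij by (auto simp: sym_mats_def) (metis carrier_matD index_transpose_mat(1))
  have edge: "{k,l} \<in> convexity_graph Q \<longleftrightarrow> 2 * Q $$ (k,l) < Q $$ (k,k) + Q $$ (l,l)"
    if "k < l" "l < n" for k l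
    using that unfolding convexity_graph_def dim
    by (smt (verit, best) doubleton_eq_iff mem_Collect_eq order.asym)
  show ?thesis
    using edge[of i j] edge[of j i] ij sym by (cases "i < j") (auto simp: insert_commute add.commute)
qed

section \<open>Clique bounds and completion\<close>

lemma ell_le_ell_principal_submatrix:
  assumes Q: "Q \<in> sym_mats n" and C: "C \<subseteq> {..<n}" "C \<noteq> {}"
  shows "ell Q \<le> ell (principal_submatrix Q C)"
proof -
  have Qc: "Q \<in> carrier_mat n n" using Q by (simp add: sym_mats_def)
  note eQ = enumerates_id[OF Qc] and eC = enumerates_principal_submatrix[OF Qc C(1)]
  have sym: "symmetric_on {..<n} (entries Q)" using enumerates_symmetric[OF eQ] Q by simp
  then have symC: "symmetric_on C (entries Q)" using C unfolding symmetric_on_def by blast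
  obtain P where P: "psd_on {..<n} P" "\<forall>i\<in>{..<n}. \<forall>j\<in>{..<n}. P i j \<le> Q $$ (i,j) - ell Q"
    using le_ell_iff[OF eQ sym, of "ell Q"] C by auto
  then have "psd_on C P" "\<forall>i\<in>C. \<forall>j\<in>C. P i j \<le> Q $$ (i,j) - ell Q"
    using psd_on_subset[OF P(1) C(1)] C(1) by blast+
  then show ?thesis using le_ell_iff[OF eC symC C(2)] by blast
qed

lemma exists_maximal_clique_ell_le_nu:
  assumes Q: "Q \<in> sym_mats n" and n: "0 < n"
  shows "\<exists>C \<in> maximal_cliques n (convexity_graph Q). ell (principal_submatrix Q C) \<le> nu Q"
proof -
  have Qc: "Q \<in> carrier_mat n n" using Q by (simp add: sym_mats_def)
  have sym: "symmetric_on {..<n} (entries Q)"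
    using enumerates_symmetric[OF enumerates_id[OF Qc]] Q by simp
  obtain x where x: "x \<in> simplex_on {..<n}" "nu Q = bilin {..<n} (entries Q) x x"
    by (rule nu_attained_on[OF Q n])
  then obtain y where y: "y \<in> simplex_on {..<n}" "bilin {..<n} (entries Q) y y \<le> nu Q"
    and cl: "\<forall>i\<in>{..<n}. \<forall>j\<in>{..<n}. y i \<noteq> 0 \<and> y j \<noteq> 0 \<and> i \<noteq> j \<longrightarrow>
      2 * Q $$ (i,j) < Q $$ (i,i) + Q $$ (j,j)"
    using simplex_descent_to_clique[OF _ sym x(1)] by (auto simp del: lessThan_iff)
  have "clique n (convexity_graph Q) {i\<in>{..<n}. y i \<noteq> 0}"
    using cl unfolding clique_def by (auto simp: convexity_graph_edge_iff[OF Q])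
  then obtain C where C: "C \<in> maximal_cliques n (convexity_graph Q)" "{i\<in>{..<n}. y i \<noteq> 0} \<subseteq> C"
    using clique_extends_to_maximal by blast
  then have Cn: "C \<subseteq> {..<n}" by (auto simp: maximal_cliques_def clique_def)
  have symC: "symmetric_on C (entries Q)" using sym Cn unfolding symmetric_on_def by blast
  have "(\<Sum>i\<in>{..<n}. y i) = (\<Sum>i\<in>C. y i)"
    using C(2) Cn by (intro sum.mono_neutral_right) auto
  then have "y \<in> simplex_on C" using y(1) Cn unfolding simplex_on_def by auto
  then have "ell (principal_submatrix Q C) \<le> bilin C (entries Q) y y"
    by (intro ell_le_quadratic_form[OF enumerates_principal_submatrix[OF Qc Cn] symC])
  also have "\<dots> = bilin {..<n} (entries Q) y y"
    unfolding bilin_def using C(2) Cn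
    by (intro sum.mono_neutral_cong_left ballI sum.mono_neutral_left) auto
  finally show ?thesis using C(1) y(2) by (intro bexI[of _ C]) auto
qed

text \<open>Only the entries of the completion on the diagonal and the edges are under control. At a non-edge
the diagonal of its positive semidefinite part provides the bound.\<close>

lemma clique_bound_le_ell:
  assumes Q: "Q \<in> sym_mats n" and n: "0 < n"
    and completable: "SPN_completable n (convexity_graph Q)"
    and bound: "\<And>C. C \<in> maximal_cliques n (convexity_graph Q) \<Longrightarrow> a \<le> ell (principal_submatrix Q C)"
  shows "a \<le> ell Q"
proof -
  let ?E = "convexity_graph Q"
  have Qc: "Q \<in> carrier_mat n n" using Q by (simp add: sym_mats_def)
  note eQ = enumerates_id[OF Qc]
  have sym: "symmetric_on {..<n} (entries Q)" using enumerates_symmetric[OF eQ] Q by simp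
  define B where "B = Matrix.mat n n (\<lambda>(i,j). if i = j \<or> {i,j} \<in> ?E then Some (Q $$ (i,j) - a) else None)"
  have Bc: "B \<in> carrier_mat n n" by (simp add: B_def)
  have "transpose_mat B = B"
    using sym by (intro eq_matI) (auto simp: B_def symmetric_on_def insert_commute)
  then have partial: "partial_mat n ?E B" using Bc unfolding partial_mat_def by (auto simp: B_def)
  \<comment> \<open>A fully specified index set is a clique, and a dual solution for a maximal clique around it
    restricts to it.\<close>
  have "map_mat the (principal_submatrix B K) \<in> SPN (card K)"
    if K: "K \<subseteq> {..<n}" "K \<noteq> {}" and spec: "\<forall>i\<in>K. \<forall>j\<in>K. B $$ (i,j) \<noteq> None" for K
  proof -
    have edge: "i = j \<or> {i,j} \<in> ?E" if "i \<in> K" "j \<in> K" for i j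
      using spec that K(1) partial unfolding partial_mat_def by blast
    then have "clique n ?E K" using K(1) unfolding clique_def by blast
    then obtain D where D: "D \<in> maximal_cliques n ?E" "K \<subseteq> D"
      using clique_extends_to_maximal by blast
    then have Dn: "D \<subseteq> {..<n}" by (auto simp: maximal_cliques_def clique_def)
    have symD: "symmetric_on D (entries Q)" using sym Dn unfolding symmetric_on_def by blast
    obtain P where P: "psd_on D P" "\<forall>i\<in>D. \<forall>j\<in>D. P i j \<le> Q $$ (i,j) - a"
      using le_ell_iff[OF enumerates_principal_submatrix[OF Qc Dn] symD, of a] bound[OF D(1)] D(2) K(2)
      by auto
    have PK: "psd_on K P" "\<forall>i\<in>K. \<forall>j\<in>K. P i j \<le> Q $$ (i,j) - a"
      using psd_on_subset[OF P(1) D(2)] P(2) D(2) finite_subset[OF Dn] by blast+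
    have pick: "pick K i \<in> K" if "i < card K" for i using pick_in_set_le that by blast
    have "enumerates (pick K) (card K) K (\<lambda>i j. Q $$ (i,j) - a) (map_mat the (principal_submatrix B K))"
      unfolding enumerates_def
    proof (intro conjI allI impI)
      show "map_mat the (principal_submatrix B K) \<in> carrier_mat (card K) (card K)"
        using dim_principal_submatrix[OF Bc K(1)] by simp
      show "bij_betw (pick K) {..<card K} K" using K(1) by (intro bij_betw_pick) (rule finite_subset, auto)
      fix i j assume ij: "i < card K" "j < card K"
      have "pick K i < n" "pick K j < n" using pick[OF ij(1)] pick[OF ij(2)] K(1) by auto
      then have "B $$ (pick K i, pick K j) = Some (Q $$ (pick K i, pick K j) - a)"
        using edge[OF pick[OF ij(1)] pick[OF ij(2)]] by (auto simp: B_def)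
      then show "map_mat the (principal_submatrix B K) $$ (i,j) = Q $$ (pick K i, pick K j) - a"
        using ij dim_principal_submatrix[OF Bc K(1)] principal_submatrix_index[OF Bc K(1) ij] by simp
    qed
    moreover have "symmetric_on K (\<lambda>i j. Q $$ (i,j) - a)"
      using sym K(1) unfolding symmetric_on_def by (metis subsetD)
    ultimately show ?thesis using PK by (subst enumerates_SPN) blast+
  qed
  then have "partial_SPN_mat n ?E B" using partial unfolding partial_SPN_mat_def by blast
  then obtain A where A: "A \<in> SPN n"
    and agree: "\<And>i j b. i < n \<Longrightarrow> j < n \<Longrightarrow> B $$ (i,j) = Some b \<Longrightarrow> A $$ (i,j) = b"
    using completable unfolding SPN_completable_def SPN_completable_mat_def by blast
  have As: "A \<in> carrier_mat n n" "A \<in> sym_mats n"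
  proof -
    obtain P N where PN: "A = P + N" "P \<in> sym_mats n" "N \<in> sym_mats n"
      using A unfolding SPN_def psd_mats_def nonneg_mats_def by blast
    then show "A \<in> carrier_mat n n" by (auto simp: sym_mats_def)
    show "A \<in> sym_mats n"
      using PN transpose_add[of P n n N] by (auto simp: sym_mats_def)
  qed
  note eA = enumerates_id[OF As(1)]
  have "symmetric_on {..<n} (entries A)" using enumerates_symmetric[OF eA] As(2) by simp
  then obtain P where P: "psd_on {..<n} P" "\<And>i j. i < n \<Longrightarrow> j < n \<Longrightarrow> P i j \<le> A $$ (i,j)"
    using enumerates_SPN[OF eA] A by auto
  have spec: "A $$ (i,j) = Q $$ (i,j) - a" if "i < n" "j < n" "i = j \<or> {i,j} \<in> ?E" for i j
    using that by (intro agree) (auto simp: B_def)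
  have "P i j \<le> Q $$ (i,j) - a" if ij: "i < n" "j < n" for i j
  proof (cases "i = j \<or> {i,j} \<in> ?E")
    case True
    then show ?thesis using P(2)[OF ij] spec[OF ij] by simp
  next
    case False
    then have "Q $$ (i,i) + Q $$ (j,j) \<le> 2 * Q $$ (i,j)"
      using convexity_graph_edge_iff[OF Q ij] by auto
    moreover have "2 * P i j \<le> P i i + P j j" using psd_on_entry_le[OF P(1), of i j] ij by simp
    moreover have "P i i \<le> Q $$ (i,i) - a" "P j j \<le> Q $$ (j,j) - a"
      using P(2)[OF ij(1) ij(1)] P(2)[OF ij(2) ij(2)] spec[of i i] spec[of j j] ij by auto
    ultimately show ?thesis by argo
  qed
  then show ?thesis using le_ell_iff[OF eQ sym, of a] P(1) n by auto
qed

theorem proposition5p1: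
  fixes Q :: "real mat" and n :: nat
  assumes "n \<ge> 1"
    and "Q \<in> sym_mats n"
    and "SPN_completable n (convexity_graph Q)"
  shows "Q \<in> exact_mats n \<longleftrightarrow>
    Min ((\<lambda>C. ell (principal_submatrix Q C)) ` maximal_cliques n (convexity_graph Q)) = nu Q"
proof -
  let ?L = "(\<lambda>C. ell (principal_submatrix Q C)) ` maximal_cliques n (convexity_graph Q)"
  have n: "0 < n" using assms(1) by simp
  have fin: "finite ?L" and ne: "?L \<noteq> {}"
    using finite_maximal_cliques maximal_cliques_nonempty by auto
  \<comment> \<open>The empty set is a clique, but not a maximal one, since \<open>n\<close> is positive.\<close>
  have "C \<subseteq> {..<n} \<and> C \<noteq> {}" if C: "C \<in> maximal_cliques n (convexity_graph Q)" for C
  proof -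
    have "clique n (convexity_graph Q) {0}" using n by (simp add: clique_def)
    then show ?thesis using C unfolding maximal_cliques_def clique_def by blast
  qed
  then have lower: "ell Q \<le> Min ?L"
    using fin ne ell_le_ell_principal_submatrix[OF assms(2)] by auto
  have upper: "Min ?L \<le> nu Q"
    using exists_maximal_clique_ell_le_nu[OF assms(2) n] fin by (meson Min_le imageI order_trans)
  have tight: "Min ?L \<le> ell Q"
    using fin by (intro clique_bound_le_ell[OF assms(2) n assms(3)]) auto
  show ?thesis using lower upper tight assms(2) unfolding exact_mats_def by auto
qed

end
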